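(* Let $n=\ell+g$ with integers $\ell\ge 1$, $g\ge 1$, let $\mu\in\mathbb{R}$, $\sigma>0$, $0\le\alpha<1$, put $\beta=\ell/(2n)$ and $\gamma=\alpha-(1-2\beta)$, and consider one step of the voting model described in the context with $\ell$ egoists and a group of $g$ members. Let $\widetilde d_{\mathcal E}$ be the actual capital increment in this step of an arbitrary fixed egoist, and let $P_G$ be the probability that the group votes "for", $Q_G=1-P_G$. Then, whether the group follows Principle A or Principle B, $$M(\widetilde d_{\mathcal E})=P_G\sum_{x=[\gamma n]+1}^{\ell}\left(\mu+\frac{\sigma f}{q}\left(\frac{x}{p\ell}-1\right)\right)b(x\mid\ell)+Q_G\sum_{x=[\alpha n]+1}^{\ell}\left(\mu+\frac{\sigma f}{q}\left(\frac{x}{p\ell}-1\right)\right)b(x\mid\ell)$$ $$=P_G\sum_{x=[\gamma n]+1}^{[\alpha n]}\left(\mu+\frac{\sigma f}{q}\left(\frac{x}{p\ell}-1\right)\right)b(x\mid\ell)+\sum_{x=[\alpha n]+1}^{\ell}\left(\mu+\frac{\sigma f}{q}\left(\frac{x}{p\ell}-1\right)\right)b(x\mid\ell),$$ where, if the group follows Principle A, $$P_G=P_G^A=\sum_{x=[g/2]+1}^{g}b(x\mid g),\qquad Q_G=Q_G^A=\sum_{x=0}^{[g/2]}b(x\mid g),$$ and, if the group follows Principle B, $$P_G=P_G^B=\Phi\left(\frac{\mu\sqrt g}{\sigma}\right),\qquad Q_G=Q_G^B=\Phi\left(-\frac{\mu\sqrt g}{\sigma}\right).$$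
   Context: Voting model (one step). There are $n$ participants: $\ell$ egoists and $g=n-\ell$ group members. An environment proposal is a random vector $(d_1,\dots,d_n)$ whose components are mutually independent with distribution $N(\mu,\sigma^2)$. Egoist $i$ votes "for" if and only if $d_i>0$. All $g$ group members vote identically: all "for" or none "for", according to the group's principle. Principle A: the group votes "for" iff the number of group members with $d_i>0$ exceeds the number of group members with $d_i<0$. Principle B: the group votes "for" iff $\sum d_i>0$, the sum being over the group members. The proposal is accepted iff more than $\alpha n$ participants vote "for". If it is accepted, the actual capital increment of participant $i$ is $\widetilde d_i=d_i$; otherwise it is $\widetilde d_i=0$. Notation: $M(\cdot)$ is expectation; $\varphi$ and $\Phi$ are the density and the cumulative distribution function of $N(0,1)$; $p=\Phi(\mu/\sigma)$, $q=1-p$, $f=\varphi(\mu/\sigma)$; $b(x\mid m)=\binom{m}{x}p^xq^{m-x}$, with $\binom{m}{x}=0$ for $x<0$ or $x>m$; $[t]$ is the integer part (floor) of $t$; a sum whose lower limit exceeds its upper limit is zero. *)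

theory Defs
  imports "HOL-Probability.Probability"
begin

definition std_normal_cdf :: "real \<Rightarrow> real" where
  "std_normal_cdf = cdf std_normal_distribution"

text \<open>The argument ranges over the integers because the lower summation limit
  \<open>\<lfloor>\<gamma> n\<rfloor> + 1\<close> may be negative; outside \<open>{0..m}\<close> the binomial coefficient is zero.\<close>

definition binom_prob :: "real \<Rightarrow> int \<Rightarrow> nat \<Rightarrow> real" where
  "binom_prob p x m =
     (if 0 \<le> x \<and> x \<le> int m
      then real (m choose nat x) * p ^ nat x * (1 - p) ^ (m - nat x) else 0)"

datatype principle = Principle_A | Principle_B

text \<open>Below, \<open>n\<close> participants are numbered \<open>1, \<dots>, n\<close>, the egoists are those in \<open>E\<close>, the
  remaining ones form the group, and \<open>x i\<close> is the capital increment proposed to participant \<open>i\<close>.\<close>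

definition group_of :: "nat \<Rightarrow> nat set \<Rightarrow> nat set" where
  "group_of n E = {1..n} - E"

fun group_votes_for :: "principle \<Rightarrow> nat set \<Rightarrow> (nat \<Rightarrow> real) \<Rightarrow> bool" where
  "group_votes_for Principle_A G x \<longleftrightarrow> card {i \<in> G. x i > 0} > card {i \<in> G. x i < 0}"
| "group_votes_for Principle_B G x \<longleftrightarrow> (\<Sum>i\<in>G. x i) > 0"

definition votes_for :: "principle \<Rightarrow> nat \<Rightarrow> nat set \<Rightarrow> (nat \<Rightarrow> real) \<Rightarrow> nat \<Rightarrow> bool" where
  "votes_for pr n E x i \<longleftrightarrow>
     (if i \<in> E then x i > 0 else group_votes_for pr (group_of n E) x)"

definition accepted :: "principle \<Rightarrow> real \<Rightarrow> nat \<Rightarrow> nat set \<Rightarrow> (nat \<Rightarrow> real) \<Rightarrow> bool" where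
  "accepted pr \<alpha> n E x \<longleftrightarrow> real (card {i \<in> {1..n}. votes_for pr n E x i}) > \<alpha> * real n"

definition actual_increment ::
    "principle \<Rightarrow> real \<Rightarrow> nat \<Rightarrow> nat set \<Rightarrow> (nat \<Rightarrow> real) \<Rightarrow> nat \<Rightarrow> real" where
  "actual_increment pr \<alpha> n E x i = (if accepted pr \<alpha> n E x then x i else 0)"

end

(* The proposal to the group is independent of the proposals to the egoists, so, given the
   group's vote, the increment of the egoist e is d_e restricted to the event that more than t
   egoists have a positive proposal, with t = \<gamma> n if the group votes "for" and t = \<alpha> n
   otherwise.  Splitting this event according to the sign of d_e leaves an independent binomial
   count over the other l - 1 egoists, and the means of the positive and nonpositive parts of d_e
   are \<mu> p + \<sigma> f and \<mu> q - \<sigma> f.  The absorption identities for binomial coefficients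
   combine the two binomial tails for l - 1 egoists into one weighted sum for l egoists. *)
theory Submission
  imports Defs "HOL-Real_Asymp.Real_Asymp"
begin

section \<open>Absorption identities for binomial weights\<close>

lemma binom_prob_of_nat:
  "binom_prob p (int k) m = real (m choose k) * p ^ k * (1 - p) ^ (m - k)"
  by (auto simp: binom_prob_def binomial_eq_0)

text \<open>By absorption, if b is the weight of x in m + 1 trials, then the weights of x - 1 and of
  x in m trials are b times x / (p (m + 1)) and b times (m + 1 - x) / ((1 - p) (m + 1)). In the
  application \<open>c\<close> is \<sigma> f and m + 1 is the number of egoists, so the coefficients
  on the left are the means of the positive and nonpositive parts of a proposal.\<close>

lemma binom_prob_Suc_recurrence:
  fixes p :: real
  assumes "p \<noteq> 0" "p \<noteq> 1"
  shows "(\<mu> * p + c) * binom_prob p (x - 1) m + (\<mu> * (1 - p) - c) * binom_prob p x m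
    = (\<mu> + c / (1 - p) * (real_of_int x / (p * real (Suc m)) - 1)) * binom_prob p x (Suc m)"
proof -
  \<comment> \<open>Absorption is needed only for x between 1 and m + 1. At x = 0 the weight of x -
    1 vanishes, and for x below 0 or above m + 1 all three weights do.\<close>
  have "x = int (Suc (nat (x - 1)))" "nat (x - 1) \<le> m" if "0 < x" "x \<le> int (Suc m)"
    using that by auto
  then consider "x < 0" | "x = 0" | k where "x = int (Suc k)" "k \<le> m" | "x > int (Suc m)"
    by (metis linorder_less_linear not_le)
  then show ?thesis
  proof cases
    case 2
    then show ?thesis
      using assms by (simp add: binom_prob_def field_simps)
  next
    case (3 k)
    define b where "b = real (Suc m choose Suc k) * p ^ Suc k * (1 - p) ^ (m - k)"
    have "real (Suc k) * real (Suc m choose Suc k) = real (Suc m) * real (m choose k)"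
      by (metis Suc_times_binomial_eq mult.commute of_nat_mult)
    then have low: "real (m choose k) * p ^ k * (1 - p) ^ (m - k) = real (Suc k) / (p * real (Suc m)) * b"
      using assms by (simp add: b_def field_simps del: of_nat_Suc binomial_Suc_Suc)
    have "real (m choose Suc k) * real (Suc m) = real (m - k) * real (Suc m choose Suc k)"
    proof -
      have "(m - k) * (Suc m choose Suc k) = Suc m * (m choose Suc k)"
        using binomial_absorb_comp[of "Suc m" "Suc k"] by simp
      then show ?thesis
        by (metis mult.commute of_nat_mult)
    qed
    moreover have "real (m - k) = real (Suc m) - real (Suc k)"
      using 3 by simp
    ultimately have "real (m choose Suc k)
        = (real (Suc m) - real (Suc k)) / real (Suc m) * real (Suc m choose Suc k)"
      by (simp add: field_simps del: of_nat_Suc binomial_Suc_Suc)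
    \<comment> \<open>For k = m the truncated difference \<open>m - Suc k\<close> breaks this power
      law, but there \<open>m choose Suc k\<close> and the factor \<open>Suc m - Suc k\<close> are
      both zero.\<close>
    moreover have "(1 - p) ^ (m - k) = (1 - p) * (1 - p) ^ (m - Suc k)" if "k < m"
      using that by (metis Suc_diff_Suc power_Suc)
    ultimately have high: "real (m choose Suc k) * p ^ Suc k * (1 - p) ^ (m - Suc k)
        = (real (Suc m) - real (Suc k)) / ((1 - p) * real (Suc m)) * b"
      using assms 3
      by (cases "k < m") (simp_all add: b_def del: of_nat_Suc binomial_Suc_Suc power_Suc)
    have "x - 1 = int k"
      using 3 by simp
    then have "(\<mu> * p + c) * binom_prob p (x - 1) m + (\<mu> * (1 - p) - c) * binom_prob p x m
      = (\<mu> * p + c) * (real (Suc k) / (p * real (Suc m)) * b)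
        + (\<mu> * (1 - p) - c) * ((real (Suc m) - real (Suc k)) / ((1 - p) * real (Suc m)) * b)"
      unfolding 3(1) binom_prob_of_nat low high by (simp only: binom_prob_of_nat low)
    \<comment> \<open>With y = (k + 1) / (m + 1), the multiples of \<mu> add up to y + (1 - y) = 1,
      and the coefficient of c is y / p - (1 - y) / (1 - p) = (y / p - 1) / (1 - p).\<close>
    also have "\<dots> = (\<mu> + c / (1 - p) * (real (Suc k) / (p * real (Suc m)) - 1)) * b"
      using assms by (simp add: divide_simps del: of_nat_Suc) (simp add: algebra_simps)
    finally show ?thesis
      unfolding 3(1) binom_prob_of_nat by (simp add: b_def del: of_nat_Suc binomial_Suc_Suc power_Suc)
  qed (auto simp: binom_prob_def)
qed

section \<open>The number of positive proposals\<close>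

context prob_space
begin

lemma integrable_indicator_event: "A \<in> events \<Longrightarrow> integrable M (indicator A :: 'a \<Rightarrow> real)"
  by (rule integrable_real_indicator) (simp_all add: emeasure_eq_measure)

lemma prob_nonpos_eq:
  fixes X :: "'a \<Rightarrow> real"
  assumes [measurable]: "random_variable borel X"
  shows "prob {\<omega> \<in> space M. X \<omega> \<le> 0} = 1 - prob {\<omega> \<in> space M. X \<omega> > 0}"
proof -
  have "{\<omega> \<in> space M. X \<omega> \<le> 0} = space M - {\<omega> \<in> space M. X \<omega> > 0}"
    by auto
  then show ?thesis
    by (simp add: prob_compl)
qed

text \<open>Prescribing the positive set confines each variable to one of the half-lines
  \<open>{0<..}\<close> and \<open>{..0}\<close>, so independence gives a product of probabilities p
  and 1 - p.\<close>

lemma prob_positive_set_eq: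
  fixes X :: "'i \<Rightarrow> 'a \<Rightarrow> real"
  assumes fin: "finite I" and indep: "indep_vars (\<lambda>_. borel) X I"
    and p: "\<And>i. i \<in> I \<Longrightarrow> prob {\<omega> \<in> space M. X i \<omega> > 0} = p" and "S \<subseteq> I"
  shows "prob {\<omega> \<in> space M. {i \<in> I. X i \<omega> > 0} = S} = p ^ card S * (1 - p) ^ (card I - card S)"
proof (cases "I = {}")
  \<comment> \<open>The product rule \<open>indep_varsD\<close> asks for a nonempty index set, so
    the empty one is treated apart.\<close>
  case True
  then show ?thesis
    using \<open>S \<subseteq> I\<close> by (simp add: prob_space)
next
  case False
  have X: "random_variable borel (X i)" if "i \<in> I" for i
    using indep that by (auto simp: indep_vars_def)
  define A where "A i = (if i \<in> S then {0<..} else {..0::real})" for i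
  have "{\<omega> \<in> space M. {i \<in> I. X i \<omega> > 0} = S} = (\<Inter>i\<in>I. X i -` A i \<inter> space M)"
    using False \<open>S \<subseteq> I\<close> by (auto simp: A_def split: if_splits)
  also have "prob \<dots> = (\<Prod>i\<in>I. prob (X i -` A i \<inter> space M))"
    by (rule indep_varsD[OF indep False fin]) (auto simp: A_def)
  also have "\<dots> = (\<Prod>i\<in>I. if i \<in> S then p else 1 - p)"
  proof (rule prod.cong[OF refl])
    fix i assume "i \<in> I"
    then show "prob (X i -` A i \<inter> space M) = (if i \<in> S then p else 1 - p)"
      using p[of i] prob_nonpos_eq[OF X[of i]]
      by (auto simp: A_def vimage_def Int_def conj_commute)
  qed
  also have "\<dots> = p ^ card S * (1 - p) ^ card (I - S)"
    using fin \<open>S \<subseteq> I\<close> by (simp add: prod.If_cases Int_absorb1 Diff_eq)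
  finally show ?thesis
    using fin \<open>S \<subseteq> I\<close> by (simp add: card_Diff_subset finite_subset)
qed

text \<open>Only the finitely many subsets of \<open>I\<close> can occur as the positive set, so any
  condition \<open>P\<close> on it describes a finite union of events. This covers the counting
  events below.\<close>

lemma events_positive_set:
  fixes X :: "'i \<Rightarrow> 'a \<Rightarrow> real"
  assumes "finite I" and "\<And>i. i \<in> I \<Longrightarrow> random_variable borel (X i)"
  shows "{\<omega> \<in> space M. P {i \<in> I. X i \<omega> > 0}} \<in> events"
proof -
  have "{\<omega> \<in> space M. {i \<in> I. X i \<omega> > 0} = S} \<in> events" for S
  proof -
    have "{\<omega> \<in> space M. {i \<in> I. X i \<omega> > 0} = S}
        = {\<omega> \<in> space M. S \<subseteq> I \<and> (\<forall>i\<in>I. X i \<omega> > 0 \<longleftrightarrow> i \<in> S)}"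
      by auto
    also have "\<dots> \<in> events"
      using assms by measurable
    finally show ?thesis .
  qed
  then have "(\<Union>S\<in>{S \<in> Pow I. P S}. {\<omega> \<in> space M. {i \<in> I. X i \<omega> > 0} = S}) \<in> events"
    using \<open>finite I\<close> by (intro sets.finite_UN) auto
  also have "(\<Union>S\<in>{S \<in> Pow I. P S}. {\<omega> \<in> space M. {i \<in> I. X i \<omega> > 0} = S})
      = {\<omega> \<in> space M. P {i \<in> I. X i \<omega> > 0}}"
    by auto
  finally show ?thesis .
qed

text \<open>The events belonging to different positive sets are disjoint, and all sets of size k
  have the same probability, so it remains to count the k-subsets of \<open>I\<close>.\<close>

lemma prob_card_positive_eq:
  fixes X :: "'i \<Rightarrow> 'a \<Rightarrow> real"
  assumes fin: "finite I" and indep: "indep_vars (\<lambda>_. borel) X I"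
    and p: "\<And>i. i \<in> I \<Longrightarrow> prob {\<omega> \<in> space M. X i \<omega> > 0} = p"
  shows "prob {\<omega> \<in> space M. card {i \<in> I. X i \<omega> > 0} = k} = binom_prob p (int k) (card I)"
proof -
  have X: "random_variable borel (X i)" if "i \<in> I" for i
    using indep that by (auto simp: indep_vars_def)
  let ?K = "{S. S \<subseteq> I \<and> card S = k}"
  have "{\<omega> \<in> space M. card {i \<in> I. X i \<omega> > 0} = k}
      = (\<Union>S\<in>?K. {\<omega> \<in> space M. {i \<in> I. X i \<omega> > 0} = S})"
    by auto
  also have "prob \<dots> = (\<Sum>S\<in>?K. prob {\<omega> \<in> space M. {i \<in> I. X i \<omega> > 0} = S})"
    using fin X
    by (intro finite_measure_finite_Union)
      (auto simp: disjoint_family_on_def intro!: events_positive_set)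
  also have "\<dots> = (\<Sum>S\<in>?K. p ^ k * (1 - p) ^ (card I - k))"
    using fin indep p by (intro sum.cong) (auto simp: prob_positive_set_eq)
  finally show ?thesis
    using fin by (simp add: n_subsets binom_prob_of_nat)
qed

text \<open>The threshold is an arbitrary real because \<gamma> n may be negative. The sum may then
  start below zero, where the events are empty and the weights are zero.\<close>

lemma prob_card_positive_gt:
  fixes X :: "'i \<Rightarrow> 'a \<Rightarrow> real"
  assumes fin: "finite I" and indep: "indep_vars (\<lambda>_. borel) X I"
    and p: "\<And>i. i \<in> I \<Longrightarrow> prob {\<omega> \<in> space M. X i \<omega> > 0} = p"
  shows "prob {\<omega> \<in> space M. real (card {i \<in> I. X i \<omega> > 0}) > t}
    = (\<Sum>x\<in>{\<lfloor>t\<rfloor> + 1..int (card I)}. binom_prob p x (card I))"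
proof -
  have X: "random_variable borel (X i)" if "i \<in> I" for i
    using indep that by (auto simp: indep_vars_def)
  have gt: "real k > t \<longleftrightarrow> int k \<ge> \<lfloor>t\<rfloor> + 1" for k
    by linarith
  let ?A = "\<lambda>x. {\<omega> \<in> space M. int (card {i \<in> I. X i \<omega> > 0}) = x}"
  have "{\<omega> \<in> space M. real (card {i \<in> I. X i \<omega> > 0}) > t} = (\<Union>x\<in>{\<lfloor>t\<rfloor> + 1..int (card I)}. ?A x)"
    using fin by (auto simp: gt intro!: card_mono)
  also have "prob \<dots> = (\<Sum>x\<in>{\<lfloor>t\<rfloor> + 1..int (card I)}. prob (?A x))"
    using fin X
    by (intro finite_measure_finite_Union)
      (auto simp: disjoint_family_on_def intro!: events_positive_set[where P = "\<lambda>S. int (card S) = _"])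
  also have "\<dots> = (\<Sum>x\<in>{\<lfloor>t\<rfloor> + 1..int (card I)}. binom_prob p x (card I))"
  proof (intro sum.cong refl)
    fix x
    show "prob (?A x) = binom_prob p x (card I)"
    proof (cases x rule: int_cases2)
      case (nonneg k)
      then show ?thesis
        using prob_card_positive_eq[OF assms, of k] by simp
    next
      case (nonpos k)
      then show ?thesis
        using prob_card_positive_eq[OF assms, of 0]
        by (cases "k = 0") (auto simp: binom_prob_def)
    qed
  qed
  finally show ?thesis .
qed

section \<open>Positive and nonpositive parts of a normal variable\<close>

text \<open>A law with a density has no atoms. This permits exchanging weak and strict inequalities
  at 0 and neglecting zero proposals in the group.\<close>

lemma normal_AE_nonzero:
  assumes X: "distributed M lborel X (normal_density \<mu> \<sigma>)"
  shows "AE \<omega> in M. X \<omega> \<noteq> 0"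
proof -
  have [measurable]: "random_variable borel X"
    using distributed_measurable[OF X] by simp
  have "AE x in lborel. ennreal (normal_density \<mu> \<sigma> x) > 0 \<longrightarrow> x \<noteq> 0"
    using AE_lborel_singleton[of "0::real"] by auto
  then have "AE x in distr M lborel X. x \<noteq> 0"
    unfolding distributed_distr_eq_density[OF X] by (subst AE_density) auto
  then show ?thesis
    by (subst (asm) AE_distr_iff) auto
qed

text \<open>The affine image \<mu> / \<sigma> - X / \<sigma> is standard normal, and it is at most
  \<mu> / \<sigma> exactly when X \<ge> 0. Since \<open>cdf\<close> measures closed half-lines, the
  null event X = 0 has to be removed at the end.\<close>

lemma normal_prob_pos:
  assumes "\<sigma> > 0" and X: "distributed M lborel X (normal_density \<mu> \<sigma>)"
  shows "prob {\<omega> \<in> space M. X \<omega> > 0} = std_normal_cdf (\<mu> / \<sigma>)"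
proof -
  have [measurable]: "random_variable borel X"
    using distributed_measurable[OF X] by simp
  have Y: "distributed M lborel (\<lambda>\<omega>. \<mu> / \<sigma> + (- 1 / \<sigma>) * X \<omega>) std_normal_density"
    using normal_density_affine[OF X, of "- 1 / \<sigma>" "\<mu> / \<sigma>"] \<open>\<sigma> > 0\<close> by simp
  have "std_normal_cdf (\<mu> / \<sigma>) = measure (distr M lborel (\<lambda>\<omega>. \<mu> / \<sigma> + (- 1 / \<sigma>) * X \<omega>)) {..\<mu> / \<sigma>}"
    using distributed_distr_eq_density[OF Y] by (simp add: std_normal_cdf_def cdf_def)
  also have "\<dots> = prob {\<omega> \<in> space M. X \<omega> \<ge> 0}"
    using \<open>\<sigma> > 0\<close>
    by (subst measure_distr) (auto intro!: arg_cong[where f = prob] simp: zero_le_divide_iff)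
  also have "\<dots> = prob {\<omega> \<in> space M. X \<omega> > 0}"
  proof (rule finite_measure_eq_AE)
    have "AE \<omega> in M. X \<omega> \<noteq> 0"
      using X by (rule normal_AE_nonzero)
    then show "AE \<omega> in M. (\<omega> \<in> {\<omega> \<in> space M. X \<omega> \<ge> 0}) = (\<omega> \<in> {\<omega> \<in> space M. X \<omega> > 0})"
      by eventually_elim auto
  qed auto
  finally show ?thesis ..
qed

text \<open>The density times x - \<mu> has the antiderivative -\<sigma>^2 times the density, so its
  integral over the positive half-line is \<sigma>^2 times the density at 0. Adding back \<mu> times
  the probability of X > 0 undoes the centring.\<close>

lemma normal_expectation_pos:
  assumes "\<sigma> > 0" and X: "distributed M lborel X (normal_density \<mu> \<sigma>)"
  shows "integrable M (\<lambda>\<omega>. X \<omega> * of_bool (X \<omega> > 0))"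
    and "expectation (\<lambda>\<omega>. X \<omega> * of_bool (X \<omega> > 0))
      = \<mu> * std_normal_cdf (\<mu> / \<sigma>) + \<sigma> * std_normal_density (\<mu> / \<sigma>)"
proof -
  have [measurable]: "random_variable borel X"
    using distributed_measurable[OF X] by simp
  have int_X: "integrable M X"
    using distributed_integrable[OF X, of "\<lambda>x. x"] integrable_normal_moment_nz_1[OF \<open>\<sigma> > 0\<close>] by simp
  have ind: "X \<omega> * of_bool (X \<omega> > 0) = X \<omega> * indicator {\<omega> \<in> space M. X \<omega> > 0} \<omega>" if "\<omega> \<in> space M" for \<omega>
    using that by simp
  have "integrable M (\<lambda>\<omega>. X \<omega> * indicator {\<omega> \<in> space M. X \<omega> > 0} \<omega>)"
    using int_X by (intro integrable_real_mult_indicator) auto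
  then show int_pos: "integrable M (\<lambda>\<omega>. X \<omega> * of_bool (X \<omega> > 0))"
    by (simp add: ind cong: Bochner_Integration.integrable_cong)
  \<comment> \<open>With the normalising factor named, the derivative, the continuity and the limit
    of the density come from the exponential alone.\<close>
  define c where "c = 1 / sqrt (2 * pi * \<sigma>\<^sup>2)"
  have density: "normal_density \<mu> \<sigma> = (\<lambda>x. c * exp (- (x - \<mu>)\<^sup>2 / (2 * \<sigma>\<^sup>2)))"
    by (simp add: normal_density_def c_def fun_eq_iff)
  let ?F = "\<lambda>x. - \<sigma>\<^sup>2 * normal_density \<mu> \<sigma> x" and ?h = "\<lambda>x. normal_density \<mu> \<sigma> x * (x - \<mu>)"
  have "(LBINT x=ereal 0..\<infinity>. ?h x) = 0 - ?F 0"
  proof (rule interval_integral_FTC_integrable)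
    show "(?F has_vector_derivative ?h x) (at x)" for x
      unfolding density has_real_derivative_iff_has_vector_derivative[symmetric]
      using \<open>\<sigma> > 0\<close>
      by (auto intro!: derivative_eq_intros simp: power2_eq_square)
    show "isCont ?h x" for x
      unfolding density using \<open>\<sigma> > 0\<close> by (intro continuous_intros) auto
    show "set_integrable lborel (einterval (ereal 0) \<infinity>) ?h"
      unfolding set_integrable_def
      using integrable_normal_moment[OF \<open>\<sigma> > 0\<close>, of \<mu> 1]
      by (intro integrable_mult_indicator) simp_all
    have "isCont ?F 0"
      unfolding density using \<open>\<sigma> > 0\<close> by (intro continuous_intros) auto
    then have "(?F \<longlongrightarrow> ?F 0) (at_right 0)"
      by (simp add: isCont_def filterlim_at_split)
    then show "((?F \<circ> real_of_ereal) \<longlongrightarrow> ?F 0) (at_right (ereal 0))"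
      by (simp add: ereal_tendsto_simps)
    have "(?F \<longlongrightarrow> 0) at_top"
      unfolding density using \<open>\<sigma> > 0\<close> by real_asymp
    then show "((?F \<circ> real_of_ereal) \<longlongrightarrow> 0) (at_left \<infinity>)"
      by (simp add: ereal_tendsto_simps)
  qed simp
  \<comment> \<open>The density of X at 0 is the standard density at \<mu> / \<sigma> divided by
    \<sigma>, which cancels one factor \<sigma>.\<close>
  also have "\<dots> = \<sigma> * std_normal_density (\<mu> / \<sigma>)"
    using \<open>\<sigma> > 0\<close>
    by (simp add: normal_density_def real_sqrt_mult power_divide power2_eq_square)
  also have "(LBINT x=ereal 0..\<infinity>. ?h x) = (\<integral>x. normal_density \<mu> \<sigma> x * ((x - \<mu>) * of_bool (x > 0)) \<partial>lborel)"
    unfolding interval_integral_to_infinity_eq set_lebesgue_integral_def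
    by (intro Bochner_Integration.integral_cong) auto
  finally have "expectation (\<lambda>\<omega>. (X \<omega> - \<mu>) * of_bool (X \<omega> > 0)) = \<sigma> * std_normal_density (\<mu> / \<sigma>)"
    using distributed_integral[OF X, of "\<lambda>x. (x - \<mu>) * of_bool (x > 0)"] by (simp add: of_bool_def)
  moreover have "expectation (\<lambda>\<omega>. (X \<omega> - \<mu>) * of_bool (X \<omega> > 0))
      = expectation (\<lambda>\<omega>. X \<omega> * of_bool (X \<omega> > 0) - \<mu> * indicator {\<omega> \<in> space M. X \<omega> > 0} \<omega>)"
    by (intro Bochner_Integration.integral_cong) (auto simp: algebra_simps)
  moreover have "\<dots> = expectation (\<lambda>\<omega>. X \<omega> * of_bool (X \<omega> > 0)) - \<mu> * std_normal_cdf (\<mu> / \<sigma>)"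
    using int_pos normal_prob_pos[OF assms] integrable_indicator_event[of "{\<omega> \<in> space M. X \<omega> > 0}"]
    by (subst Bochner_Integration.integral_diff) auto
  ultimately show "expectation (\<lambda>\<omega>. X \<omega> * of_bool (X \<omega> > 0))
      = \<mu> * std_normal_cdf (\<mu> / \<sigma>) + \<sigma> * std_normal_density (\<mu> / \<sigma>)"
    by simp
qed

lemma normal_expectation_nonpos:
  assumes "\<sigma> > 0" and X: "distributed M lborel X (normal_density \<mu> \<sigma>)"
  shows "integrable M (\<lambda>\<omega>. X \<omega> * of_bool (X \<omega> \<le> 0))"
    and "expectation (\<lambda>\<omega>. X \<omega> * of_bool (X \<omega> \<le> 0))
      = \<mu> * (1 - std_normal_cdf (\<mu> / \<sigma>)) - \<sigma> * std_normal_density (\<mu> / \<sigma>)"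
proof -
  have eq: "(\<lambda>\<omega>. X \<omega> * of_bool (X \<omega> \<le> 0)) = (\<lambda>\<omega>. X \<omega> - X \<omega> * of_bool (X \<omega> > 0))"
    by (auto simp: of_bool_def)
  have int_X: "integrable M X"
    using distributed_integrable[OF X, of "\<lambda>x. x"] integrable_normal_moment_nz_1[OF \<open>\<sigma> > 0\<close>] by simp
  show "integrable M (\<lambda>\<omega>. X \<omega> * of_bool (X \<omega> \<le> 0))"
    unfolding eq using int_X normal_expectation_pos[OF assms] by simp
  show "expectation (\<lambda>\<omega>. X \<omega> * of_bool (X \<omega> \<le> 0))
      = \<mu> * (1 - std_normal_cdf (\<mu> / \<sigma>)) - \<sigma> * std_normal_density (\<mu> / \<sigma>)"
    unfolding eq using int_X normal_expectation_pos[OF assms] normal_distributed_expectation[OF assms]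
    by (simp add: algebra_simps)
qed

text \<open>If \<open>X\<close> were almost surely nonpositive (positive), its positive (nonpositive) part would have
  mean zero; but by the formulas above that mean would be \<open>\<plusminus> \<sigma> \<phi>(\<mu> / \<sigma>) \<noteq> 0\<close>.\<close>
lemma normal_prob_pos_nontrivial:
  assumes "\<sigma> > 0" and X: "distributed M lborel X (normal_density \<mu> \<sigma>)"
  shows "std_normal_cdf (\<mu> / \<sigma>) \<noteq> 0" and "std_normal_cdf (\<mu> / \<sigma>) \<noteq> 1"
proof -
  have [measurable]: "random_variable borel X"
    using distributed_measurable[OF X] by simp
  have pos: "std_normal_density (\<mu> / \<sigma>) > 0"
    by (simp add: normal_density_pos)
  show "std_normal_cdf (\<mu> / \<sigma>) \<noteq> 0"
  proof
    assume 0: "std_normal_cdf (\<mu> / \<sigma>) = 0"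
    then have "AE \<omega> in M. \<not> X \<omega> > 0"
      using prob_eq_0[of "{\<omega> \<in> space M. X \<omega> > 0}"] normal_prob_pos[OF assms] by auto
    then have "expectation (\<lambda>\<omega>. X \<omega> * of_bool (X \<omega> > 0)) = 0"
      by (intro integral_eq_zero_AE) auto
    then show False
      using normal_expectation_pos(2)[OF assms] 0 pos \<open>\<sigma> > 0\<close> by simp
  qed
  show "std_normal_cdf (\<mu> / \<sigma>) \<noteq> 1"
  proof
    assume 1: "std_normal_cdf (\<mu> / \<sigma>) = 1"
    then have "AE \<omega> in M. X \<omega> > 0"
      using prob_eq_1[of "{\<omega> \<in> space M. X \<omega> > 0}"] normal_prob_pos[OF assms] by auto
    then have "expectation (\<lambda>\<omega>. X \<omega> * of_bool (X \<omega> \<le> 0)) = 0"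
      by (intro integral_eq_zero_AE) auto
    then show False
      using normal_expectation_nonpos(2)[OF assms] 1 pos \<open>\<sigma> > 0\<close> by simp
  qed
qed

section \<open>Functions of disjoint blocks of independent variables\<close>

text \<open>The two \<open>restrict\<close> conditions say that \<open>F\<close> and
  \<open>G\<close> read only the coordinates in \<open>A\<close> and \<open>B\<close>. They can
  therefore be applied to the whole vector of proposals, while independence is used for the
  restricted vectors in the product spaces.\<close>

lemma indep_blocks_expectation:
  fixes X :: "'i \<Rightarrow> 'a \<Rightarrow> real"
  assumes indep: "indep_vars (\<lambda>_. borel) X I" and disj: "A \<inter> B = {}" "A \<subseteq> I" "B \<subseteq> I"
    and F: "F \<in> borel_measurable (Pi\<^sub>M A (\<lambda>_. borel))" "\<And>x. F (restrict x A) = F x"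
    and G: "G \<in> borel_measurable (Pi\<^sub>M B (\<lambda>_. borel))" "\<And>x. G (restrict x B) = G x"
    and int: "integrable M (\<lambda>\<omega>. F (\<lambda>i. X i \<omega>))" "integrable M (\<lambda>\<omega>. G (\<lambda>i. X i \<omega>))"
  shows "integrable M (\<lambda>\<omega>. F (\<lambda>i. X i \<omega>) * G (\<lambda>i. X i \<omega>))"
    and "expectation (\<lambda>\<omega>. F (\<lambda>i. X i \<omega>) * G (\<lambda>i. X i \<omega>))
      = expectation (\<lambda>\<omega>. F (\<lambda>i. X i \<omega>)) * expectation (\<lambda>\<omega>. (G (\<lambda>i. X i \<omega>) :: real))"
proof -
  have "indep_var borel (F \<circ> (\<lambda>\<omega>. restrict (\<lambda>i. X i \<omega>) A)) borel (G \<circ> (\<lambda>\<omega>. restrict (\<lambda>i. X i \<omega>) B))"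
    by (intro indep_var_compose[OF indep_var_restrict[OF indep disj]] F G)
  then have ind: "indep_var borel (\<lambda>\<omega>. F (\<lambda>i. X i \<omega>)) borel (\<lambda>\<omega>. G (\<lambda>i. X i \<omega>))"
    by (simp add: comp_def F(2) G(2))
  show "integrable M (\<lambda>\<omega>. F (\<lambda>i. X i \<omega>) * G (\<lambda>i. X i \<omega>))"
    by (rule indep_var_integrable[OF ind int])
  show "expectation (\<lambda>\<omega>. F (\<lambda>i. X i \<omega>) * G (\<lambda>i. X i \<omega>))
      = expectation (\<lambda>\<omega>. F (\<lambda>i. X i \<omega>)) * expectation (\<lambda>\<omega>. G (\<lambda>i. X i \<omega>))"
    by (rule indep_var_lebesgue_integral[OF ind int])
qed

section \<open>Measurability of the counts and of the group vote\<close>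

text \<open>Written as a finite sum of indicators, the count inherits measurability from the
  coordinate maps.\<close>

lemma borel_measurable_card_positive_gt:
  "finite A \<Longrightarrow> (\<lambda>x. of_bool (real (card {i \<in> A. x i > 0}) > t) :: real)
    \<in> borel_measurable (Pi\<^sub>M A (\<lambda>_. borel :: real measure))"
proof -
  assume fin: "finite A"
  have count: "real (card {i \<in> A. x i > 0}) = (\<Sum>i\<in>A. if x i > 0 then 1 else 0)" for x :: "_ \<Rightarrow> real"
    using fin by (simp add: sum.If_cases Int_def)
  show ?thesis
    unfolding of_bool_def count by measurable
qed

lemma borel_measurable_group_votes_for:
  assumes "finite G"
  shows "(\<lambda>x. of_bool (group_votes_for pr G x) :: real) \<in> borel_measurable (Pi\<^sub>M G (\<lambda>_. borel))"
proof (cases pr)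
  case Principle_A
  have count: "real (card {i \<in> G. x i > 0}) = (\<Sum>i\<in>G. if x i > 0 then 1 else 0)"
    "real (card {i \<in> G. x i < 0}) = (\<Sum>i\<in>G. if x i < 0 then 1 else 0)" for x :: "_ \<Rightarrow> real"
    using assms by (simp_all add: sum.If_cases Int_def)
  have majority: "group_votes_for pr G x \<longleftrightarrow>
      (\<Sum>i\<in>G. if x i > 0 then 1 else 0) > (\<Sum>i\<in>G. if x i < 0 then 1 else 0 :: real)" for x
    unfolding Principle_A group_votes_for.simps count[symmetric] by simp
  show ?thesis
    unfolding of_bool_def majority by measurable
next
  case Principle_B
  show ?thesis
    unfolding of_bool_def Principle_B group_votes_for.simps by measurable
qed

text \<open>This is the locality condition that \<open>indep_blocks_expectation\<close> imposes on a
  function of the block \<open>G\<close>.\<close>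

lemma group_votes_for_restrict: "group_votes_for pr G (restrict x G) = group_votes_for pr G x"
proof -
  have "{i \<in> G. restrict x G i > 0} = {i \<in> G. x i > 0}" "{i \<in> G. restrict x G i < 0} = {i \<in> G. x i < 0}"
    by auto
  moreover have "(\<Sum>i\<in>G. restrict x G i) = (\<Sum>i\<in>G. x i)"
    by (rule sum.cong) auto
  ultimately show ?thesis
    by (cases pr) (simp_all only: group_votes_for.simps)
qed

lemma events_group_votes_for:
  assumes "finite G" and d: "\<And>i. i \<in> G \<Longrightarrow> random_variable borel (d i)"
  shows "{\<omega> \<in> space M. group_votes_for pr G (\<lambda>i. d i \<omega>)} \<in> events"
proof -
  have "(\<lambda>\<omega>. restrict (\<lambda>i. d i \<omega>) G) \<in> measurable M (Pi\<^sub>M G (\<lambda>_. borel))"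
    using d by (intro measurable_restrict)
  from measurable_compose[OF this borel_measurable_group_votes_for[OF \<open>finite G\<close>, of pr]]
  have "(\<lambda>\<omega>. of_bool (group_votes_for pr G (\<lambda>i. d i \<omega>)) :: real) \<in> borel_measurable M"
    by (simp add: group_votes_for_restrict)
  then have "{\<omega> \<in> space M. (of_bool (group_votes_for pr G (\<lambda>i. d i \<omega>)) :: real) = 1} \<in> events"
    by measurable
  then show ?thesis
    by simp
qed

section \<open>Mean of one egoist's proposal under a threshold on the egoists' votes\<close>

text \<open>The threshold \<open>t\<close> stays free because the theorem takes both \<gamma> n and
  \<alpha> n for it.\<close>

lemma expectation_times_card_gt:
  fixes d :: "'i \<Rightarrow> 'a \<Rightarrow> real"
  assumes "\<sigma> > 0" and fin: "finite E" and "e \<in> E" and indep: "indep_vars (\<lambda>_. borel) d E"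
    and d: "\<And>i. i \<in> E \<Longrightarrow> distributed M lborel (d i) (normal_density \<mu> \<sigma>)"
    and p: "p = std_normal_cdf (\<mu> / \<sigma>)" and f: "f = std_normal_density (\<mu> / \<sigma>)"
  shows "integrable M (\<lambda>\<omega>. d e \<omega> * of_bool (real (card {i \<in> E. d i \<omega> > 0}) > t))"
    and "expectation (\<lambda>\<omega>. d e \<omega> * of_bool (real (card {i \<in> E. d i \<omega> > 0}) > t))
      = (\<Sum>x\<in>{\<lfloor>t\<rfloor> + 1..int (card E)}.
          (\<mu> + \<sigma> * f / (1 - p) * (real_of_int x / (p * real (card E)) - 1)) * binom_prob p x (card E))"
proof -
  have d_meas: "random_variable borel (d i)" if "i \<in> E" for i
    using distributed_measurable[OF d[OF that]] by simp
  define m where "m = card (E - {e})"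
  have card_E: "card E = Suc m"
    unfolding m_def using fin \<open>e \<in> E\<close> by (metis card.remove)
  let ?tail = "\<lambda>s (x :: 'i \<Rightarrow> real). of_bool (real (card {i \<in> E - {e}. x i > 0}) > s) :: real"
  have card_split: "card {i \<in> E. x i > 0} = of_bool (x e > 0) + card {i \<in> E - {e}. x i > 0}"
    for x :: "'i \<Rightarrow> real"
  proof -
    have "{i \<in> E. x i > 0} = (if x e > 0 then {e} else {}) \<union> {i \<in> E - {e}. x i > 0}"
      using \<open>e \<in> E\<close> by auto
    then show ?thesis
      using fin by simp
  qed
  \<comment> \<open>A positive \<open>d e\<close> contributes one vote itself, so the other egoists
    only have to exceed t - 1; otherwise they have to exceed t.\<close>
  have split: "d e \<omega> * of_bool (real (card {i \<in> E. d i \<omega> > 0}) > t)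
      = d e \<omega> * of_bool (d e \<omega> > 0) * ?tail (t - 1) (\<lambda>i. d i \<omega>)
        + d e \<omega> * of_bool (d e \<omega> \<le> 0) * ?tail t (\<lambda>i. d i \<omega>)" for \<omega>
    unfolding card_split[of "\<lambda>i. d i \<omega>"] by (auto simp: of_bool_def)
  have tail_meas: "?tail s \<in> borel_measurable (Pi\<^sub>M (E - {e}) (\<lambda>_. borel))" for s
    using fin by (intro borel_measurable_card_positive_gt) auto
  have tail_events: "{\<omega> \<in> space M. real (card {i \<in> E - {e}. d i \<omega> > 0}) > s} \<in> events" for s
    using fin d_meas by (intro events_positive_set) auto
  have tail_eq: "?tail s (\<lambda>i. d i \<omega>) = indicator {\<omega> \<in> space M. real (card {i \<in> E - {e}. d i \<omega> > 0}) > s} \<omega>"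
    if "\<omega> \<in> space M" for s \<omega>
    using that by simp
  have tail_int: "integrable M (\<lambda>\<omega>. ?tail s (\<lambda>i. d i \<omega>))" for s
    using integrable_indicator_event[OF tail_events]
    by (subst Bochner_Integration.integrable_cong[OF refl tail_eq])
  have tail: "expectation (\<lambda>\<omega>. ?tail s (\<lambda>i. d i \<omega>)) = (\<Sum>x\<in>{\<lfloor>s\<rfloor> + 1..int m}. binom_prob p x m)" for s
  proof -
    have "expectation (\<lambda>\<omega>. ?tail s (\<lambda>i. d i \<omega>))
        = prob {\<omega> \<in> space M. real (card {i \<in> E - {e}. d i \<omega> > 0}) > s}"
      by (subst Bochner_Integration.integral_cong[OF refl tail_eq]) (use tail_events in simp_all)
    also have "\<dots> = (\<Sum>x\<in>{\<lfloor>s\<rfloor> + 1..int m}. binom_prob p x m)"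
      unfolding m_def using fin d \<open>\<sigma> > 0\<close>
      by (intro prob_card_positive_gt indep_vars_subset[OF indep]) (auto simp: p normal_prob_pos)
    finally show ?thesis .
  qed
  have block: "{e} \<inter> (E - {e}) = {}" "{e} \<subseteq> E" "E - {e} \<subseteq> E"
    using \<open>e \<in> E\<close> by auto
  have tail_restrict: "?tail s (restrict x (E - {e})) = ?tail s x" for s x
  proof -
    have "{i \<in> E - {e}. restrict x (E - {e}) i > 0} = {i \<in> E - {e}. x i > 0}"
      by auto
    then show ?thesis
      by (simp only:)
  qed
  \<comment> \<open>The blocks are {e} and the other egoists. Measurability and locality of the
    factor in \<open>d e\<close> are still open here and are supplied where the facts are
    applied.\<close>
  note pos = indep_blocks_expectation[OF indep block,
      where F = "\<lambda>x. x e * of_bool (x e > 0)" and G = "?tail (t - 1)",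
      OF _ _ tail_meas tail_restrict normal_expectation_pos(1)[OF \<open>\<sigma> > 0\<close> d[OF \<open>e \<in> E\<close>]] tail_int]
  note nonpos = indep_blocks_expectation[OF indep block,
      where F = "\<lambda>x. x e * of_bool (x e \<le> 0)" and G = "?tail t",
      OF _ _ tail_meas tail_restrict normal_expectation_nonpos(1)[OF \<open>\<sigma> > 0\<close> d[OF \<open>e \<in> E\<close>]] tail_int]
  have meas: "(\<lambda>x. x e * of_bool (x e > 0)) \<in> borel_measurable (Pi\<^sub>M {e} (\<lambda>_. borel :: real measure))"
    "(\<lambda>x. x e * of_bool (x e \<le> 0)) \<in> borel_measurable (Pi\<^sub>M {e} (\<lambda>_. borel :: real measure))"
    unfolding of_bool_def by measurable
  have int_pos: "integrable M (\<lambda>\<omega>. d e \<omega> * of_bool (d e \<omega> > 0) * ?tail (t - 1) (\<lambda>i. d i \<omega>))"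
    by (rule pos(1)) (use meas in auto)
  have int_nonpos: "integrable M (\<lambda>\<omega>. d e \<omega> * of_bool (d e \<omega> \<le> 0) * ?tail t (\<lambda>i. d i \<omega>))"
    by (rule nonpos(1)) (use meas in auto)
  show "integrable M (\<lambda>\<omega>. d e \<omega> * of_bool (real (card {i \<in> E. d i \<omega> > 0}) > t))"
    unfolding split using int_pos int_nonpos by (rule Bochner_Integration.integrable_add)
  have "expectation (\<lambda>\<omega>. d e \<omega> * of_bool (real (card {i \<in> E. d i \<omega> > 0}) > t))
      = expectation (\<lambda>\<omega>. d e \<omega> * of_bool (d e \<omega> > 0) * ?tail (t - 1) (\<lambda>i. d i \<omega>))
        + expectation (\<lambda>\<omega>. d e \<omega> * of_bool (d e \<omega> \<le> 0) * ?tail t (\<lambda>i. d i \<omega>))"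
    unfolding split using int_pos int_nonpos by (rule Bochner_Integration.integral_add)
  also have "expectation (\<lambda>\<omega>. d e \<omega> * of_bool (d e \<omega> > 0) * ?tail (t - 1) (\<lambda>i. d i \<omega>))
      = (\<mu> * p + \<sigma> * f) * (\<Sum>x\<in>{\<lfloor>t - 1\<rfloor> + 1..int m}. binom_prob p x m)"
  proof -
    have "expectation (\<lambda>\<omega>. d e \<omega> * of_bool (d e \<omega> > 0) * ?tail (t - 1) (\<lambda>i. d i \<omega>))
        = expectation (\<lambda>\<omega>. d e \<omega> * of_bool (d e \<omega> > 0)) * expectation (\<lambda>\<omega>. ?tail (t - 1) (\<lambda>i. d i \<omega>))"
      by (rule pos(2)) (use meas in auto)
    then show ?thesis
      by (simp only: tail normal_expectation_pos(2)[OF \<open>\<sigma> > 0\<close> d[OF \<open>e \<in> E\<close>]] p f)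
  qed
  \<comment> \<open>Since \<lfloor>t - 1\<rfloor> + 1 = \<lfloor>t\<rfloor>, shifting the index by
    one makes this tail start at \<lfloor>t\<rfloor> + 1, like the other one, and end at m +
    1.\<close>
  also have "(\<Sum>x\<in>{\<lfloor>t - 1\<rfloor> + 1..int m}. binom_prob p x m)
      = (\<Sum>x\<in>{\<lfloor>t\<rfloor> + 1..int (Suc m)}. binom_prob p (x - 1) m)"
    by (rule sum.reindex_bij_witness[of _ "\<lambda>x. x - 1" "\<lambda>x. x + 1"]) auto
  also have "expectation (\<lambda>\<omega>. d e \<omega> * of_bool (d e \<omega> \<le> 0) * ?tail t (\<lambda>i. d i \<omega>))
      = (\<mu> * (1 - p) - \<sigma> * f) * (\<Sum>x\<in>{\<lfloor>t\<rfloor> + 1..int m}. binom_prob p x m)"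
  proof -
    have "expectation (\<lambda>\<omega>. d e \<omega> * of_bool (d e \<omega> \<le> 0) * ?tail (t) (\<lambda>i. d i \<omega>))
        = expectation (\<lambda>\<omega>. d e \<omega> * of_bool (d e \<omega> \<le> 0)) * expectation (\<lambda>\<omega>. ?tail (t) (\<lambda>i. d i \<omega>))"
      by (rule nonpos(2)) (use meas in auto)
    then show ?thesis
      by (simp only: tail normal_expectation_nonpos(2)[OF \<open>\<sigma> > 0\<close> d[OF \<open>e \<in> E\<close>]] p f)
  qed
  \<comment> \<open>The only index that can be added is m + 1, whose weight in m trials is zero; now
    both tails have the same range.\<close>
  also have "(\<Sum>x\<in>{\<lfloor>t\<rfloor> + 1..int m}. binom_prob p x m)
      = (\<Sum>x\<in>{\<lfloor>t\<rfloor> + 1..int (Suc m)}. binom_prob p x m)"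
    by (rule sum.mono_neutral_left) (auto simp: binom_prob_def)
  also have "(\<mu> * p + \<sigma> * f) * (\<Sum>x\<in>{\<lfloor>t\<rfloor> + 1..int (Suc m)}. binom_prob p (x - 1) m)
        + (\<mu> * (1 - p) - \<sigma> * f) * (\<Sum>x\<in>{\<lfloor>t\<rfloor> + 1..int (Suc m)}. binom_prob p x m)
      = (\<Sum>x\<in>{\<lfloor>t\<rfloor> + 1..int (Suc m)}.
          (\<mu> * p + \<sigma> * f) * binom_prob p (x - 1) m + (\<mu> * (1 - p) - \<sigma> * f) * binom_prob p x m)"
    by (simp only: sum_distrib_left sum.distrib)
  \<comment> \<open>The recurrence applies term by term; p and 1 - p are nonzero by
    \<open>normal_prob_pos_nontrivial\<close>.\<close>
  also have "\<dots> = (\<Sum>x\<in>{\<lfloor>t\<rfloor> + 1..int (card E)}.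
      (\<mu> + \<sigma> * f / (1 - p) * (real_of_int x / (p * real (card E)) - 1)) * binom_prob p x (card E))"
    unfolding card_E
    by (intro sum.cong refl binom_prob_Suc_recurrence)
      (use normal_prob_pos_nontrivial[OF \<open>\<sigma> > 0\<close> d[OF \<open>e \<in> E\<close>]] p in auto)
  finally show "expectation (\<lambda>\<omega>. d e \<omega> * of_bool (real (card {i \<in> E. d i \<omega> > 0}) > t))
      = (\<Sum>x\<in>{\<lfloor>t\<rfloor> + 1..int (card E)}.
          (\<mu> + \<sigma> * f / (1 - p) * (real_of_int x / (p * real (card E)) - 1)) * binom_prob p x (card E))" .
qed

section \<open>The probability that the group votes for the proposal\<close>

text \<open>Almost surely no proposal is zero, so the positive and negative ones add up to
  \<open>card G\<close>, and the positive ones prevail exactly when they exceed half of it.\<close>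

lemma prob_majority_normal:
  fixes d :: "nat \<Rightarrow> 'a \<Rightarrow> real"
  assumes "\<sigma> > 0" and fin: "finite G" and indep: "indep_vars (\<lambda>_. borel) d G"
    and d: "\<And>i. i \<in> G \<Longrightarrow> distributed M lborel (d i) (normal_density \<mu> \<sigma>)"
    and p: "p = std_normal_cdf (\<mu> / \<sigma>)"
  shows "prob {\<omega> \<in> space M. card {i \<in> G. d i \<omega> > 0} > card {i \<in> G. d i \<omega> < 0}}
      = (\<Sum>x\<in>{\<lfloor>real (card G) / 2\<rfloor> + 1..int (card G)}. binom_prob p x (card G))"
    and "1 - prob {\<omega> \<in> space M. card {i \<in> G. d i \<omega> > 0} > card {i \<in> G. d i \<omega> < 0}}
      = (\<Sum>x\<in>{0..\<lfloor>real (card G) / 2\<rfloor>}. binom_prob p x (card G))"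
proof -
  have d_meas[measurable]: "random_variable borel (d i)" if "i \<in> G" for i
    using distributed_measurable[OF d[OF that]] by simp
  have count: "prob {\<omega> \<in> space M. real (card {i \<in> G. d i \<omega> > 0}) > t}
      = (\<Sum>x\<in>{\<lfloor>t\<rfloor> + 1..int (card G)}. binom_prob p x (card G))" for t
    using fin indep d \<open>\<sigma> > 0\<close> by (intro prob_card_positive_gt) (auto simp: p normal_prob_pos)
  have nz: "AE \<omega> in M. \<forall>i\<in>G. d i \<omega> \<noteq> 0"
    using fin d normal_AE_nonzero by (intro AE_finite_allI) auto
  have "prob {\<omega> \<in> space M. card {i \<in> G. d i \<omega> > 0} > card {i \<in> G. d i \<omega> < 0}}
      = prob {\<omega> \<in> space M. real (card {i \<in> G. d i \<omega> > 0}) > real (card G) / 2}"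
  proof (rule finite_measure_eq_AE)
    show "AE \<omega> in M. (\<omega> \<in> {\<omega> \<in> space M. card {i \<in> G. d i \<omega> > 0} > card {i \<in> G. d i \<omega> < 0}})
        = (\<omega> \<in> {\<omega> \<in> space M. real (card {i \<in> G. d i \<omega> > 0}) > real (card G) / 2})"
      using nz
    proof eventually_elim
      case (elim \<omega>)
      then have "G = {i \<in> G. d i \<omega> > 0} \<union> {i \<in> G. d i \<omega> < 0}"
        by (auto simp: neq_iff)
      then have "card G = card {i \<in> G. d i \<omega> > 0} + card {i \<in> G. d i \<omega> < 0}"
        using fin by (metis (no_types, lifting) card_Un_disjoint disjoint_iff finite_Un mem_Collect_eq order_less_asym)
      then show ?case
        by auto
    qed
    show "{\<omega> \<in> space M. card {i \<in> G. d i \<omega> > 0} > card {i \<in> G. d i \<omega> < 0}} \<in> events"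
      using events_group_votes_for[OF fin d_meas, where pr = Principle_A] by simp
    show "{\<omega> \<in> space M. real (card {i \<in> G. d i \<omega> > 0}) > real (card G) / 2} \<in> events"
      using fin d_meas by (intro events_positive_set) auto
  qed
  then show P: "prob {\<omega> \<in> space M. card {i \<in> G. d i \<omega> > 0} > card {i \<in> G. d i \<omega> < 0}}
      = (\<Sum>x\<in>{\<lfloor>real (card G) / 2\<rfloor> + 1..int (card G)}. binom_prob p x (card G))"
    by (simp only: count)
  \<comment> \<open>Every count exceeds -1, so this threshold yields total probability one, from
    which the tail above one half is split off.\<close>
  have "1 = (\<Sum>x\<in>{0..int (card G)}. binom_prob p x (card G))"
  proof -
    have "\<lfloor>- 1 :: real\<rfloor> + 1 = 0" "{\<omega> \<in> space M. real (card {i \<in> G. d i \<omega> > 0}) > - 1} = space M"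
      by (linarith, auto intro: less_le_trans[of "- 1" 0])
    then show ?thesis
      using count[of "- 1"] by (simp only: prob_space)
  qed
  also have "{0..int (card G)} = {0..\<lfloor>real (card G) / 2\<rfloor>} \<union> {\<lfloor>real (card G) / 2\<rfloor> + 1..int (card G)}"
  proof -
    have "{0..c} = {0..h} \<union> {h + 1..c}" if "0 \<le> h" "h \<le> c" for h c :: int
      using that by auto
    then show ?thesis
      by this linarith+
  qed
  also have "(\<Sum>x\<in>\<dots>. binom_prob p x (card G)) = (\<Sum>x\<in>{0..\<lfloor>real (card G) / 2\<rfloor>}. binom_prob p x (card G))
      + (\<Sum>x\<in>{\<lfloor>real (card G) / 2\<rfloor> + 1..int (card G)}. binom_prob p x (card G))"
    by (rule sum.union_disjoint) auto
  finally show "1 - prob {\<omega> \<in> space M. card {i \<in> G. d i \<omega> > 0} > card {i \<in> G. d i \<omega> < 0}}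
      = (\<Sum>x\<in>{0..\<lfloor>real (card G) / 2\<rfloor>}. binom_prob p x (card G))"
    by (simp add: P)
qed

text \<open>The sum is normal with mean \<open>card G\<close> times \<mu> and deviation \<sigma>
  times the root of \<open>card G\<close>, which is positive because the group is nonempty. The
  quotient of the two is the argument of the cdf.\<close>

lemma prob_sum_pos_normal:
  fixes d :: "'i \<Rightarrow> 'a \<Rightarrow> real"
  assumes "\<sigma> > 0" and "finite G" "G \<noteq> {}" and indep: "indep_vars (\<lambda>_. borel) d G"
    and d: "\<And>i. i \<in> G \<Longrightarrow> distributed M lborel (d i) (normal_density \<mu> \<sigma>)"
  shows "prob {\<omega> \<in> space M. (\<Sum>i\<in>G. d i \<omega>) > 0} = std_normal_cdf (\<mu> * sqrt (real (card G)) / \<sigma>)"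
proof -
  have "distributed M lborel (\<lambda>\<omega>. \<Sum>i\<in>G. d i \<omega>)
      (normal_density (\<Sum>i\<in>G. \<mu>) (sqrt (\<Sum>i\<in>G. \<sigma>\<^sup>2)))"
    using assms by (intro sum_indep_normal) auto
  then have "distributed M lborel (\<lambda>\<omega>. \<Sum>i\<in>G. d i \<omega>)
      (normal_density (real (card G) * \<mu>) (sqrt (real (card G)) * \<sigma>))"
    using \<open>\<sigma> > 0\<close> by (simp add: real_sqrt_mult)
  moreover have pos: "sqrt (real (card G)) > 0"
    using assms by (simp add: card_gt_0_iff)
  moreover have "real (card G) * \<mu> / (sqrt (real (card G)) * \<sigma>) = \<mu> * sqrt (real (card G)) / \<sigma>"
    using pos \<open>\<sigma> > 0\<close> by (simp add: field_simps)
  ultimately show ?thesis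
    using \<open>\<sigma> > 0\<close> normal_prob_pos[of "sqrt (real (card G)) * \<sigma>"] by simp
qed

end

text \<open>For standard normal x, both z + x and -z - x are normal with variance one. By
  \<open>normal_prob_pos\<close> the two cdf values are the probabilities that these are positive,
  and the two events are complementary up to the null event z + x = 0.\<close>

lemma std_normal_cdf_minus: "std_normal_cdf (- z) = 1 - std_normal_cdf z"
proof -
  interpret N: prob_space std_normal_distribution
    using real_dist_normal_dist by (simp add: real_distribution_def)
  have "distributed std_normal_distribution lborel (\<lambda>x. x) std_normal_density"
    by (auto simp: distributed_def distr_id[of lborel, simplified] intro!: measure_eqI simp: emeasure_distr)
  from N.normal_density_affine[OF this, of 1 z] N.normal_density_affine[OF this, of "-1" "- z"]
  have X: "distributed std_normal_distribution lborel (\<lambda>x. z + x) (normal_density z 1)"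
    and Y: "distributed std_normal_distribution lborel (\<lambda>x. - z - x) (normal_density (- z) 1)"
    by simp_all
  have "std_normal_cdf (- z) = N.prob {x \<in> space std_normal_distribution. - z - x > 0}"
    using N.normal_prob_pos[OF _ Y] by simp
  also have "\<dots> = N.prob {x \<in> space std_normal_distribution. z + x \<le> 0}"
    using N.normal_AE_nonzero[OF X] by (intro N.finite_measure_eq_AE) auto
  also have "\<dots> = 1 - std_normal_cdf z"
    using N.normal_prob_pos[OF _ X] by (subst N.prob_nonpos_eq) auto
  finally show ?thesis .
qed

section \<open>The mean increment of an egoist\<close>

theorem mainTheorem1:
  fixes M :: "'a measure" and d :: "nat \<Rightarrow> 'a \<Rightarrow> real"
    and l g n e :: nat and E :: "nat set" and pr :: principle
    and \<mu> \<sigma> \<alpha> \<beta> \<gamma> p q f P_G Q_G :: real and T :: "int \<Rightarrow> real"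
  assumes "l \<ge> 1" and "g \<ge> 1" and "n = l + g"
    and "\<sigma> > 0" and "0 \<le> \<alpha>" and "\<alpha> < 1"
    and "\<beta> = real l / (2 * real n)" and "\<gamma> = \<alpha> - (1 - 2 * \<beta>)"
    and "prob_space M"
    and "prob_space.indep_vars M (\<lambda>_. borel) d {1..n}"
    and "\<And>i. i \<in> {1..n} \<Longrightarrow> distributed M lborel (d i) (normal_density \<mu> \<sigma>)"
    and "E \<subseteq> {1..n}" and "card E = l" and "e \<in> E"
    and "p = std_normal_cdf (\<mu> / \<sigma>)" and "q = 1 - p" and "f = std_normal_density (\<mu> / \<sigma>)"
    and "P_G = measure M {\<omega> \<in> space M. group_votes_for pr (group_of n E) (\<lambda>i. d i \<omega>)}"
    and "Q_G = 1 - P_G"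
    and "\<And>x. T x = (\<mu> + \<sigma> * f / q * (real_of_int x / (p * real l) - 1)) * binom_prob p x l"
  shows "integrable M (\<lambda>\<omega>. actual_increment pr \<alpha> n E (\<lambda>i. d i \<omega>) e)
    \<and> (\<integral>\<omega>. actual_increment pr \<alpha> n E (\<lambda>i. d i \<omega>) e \<partial>M)
        = P_G * (\<Sum>x\<in>{\<lfloor>\<gamma> * real n\<rfloor> + 1..int l}. T x)
          + Q_G * (\<Sum>x\<in>{\<lfloor>\<alpha> * real n\<rfloor> + 1..int l}. T x)
    \<and> (\<integral>\<omega>. actual_increment pr \<alpha> n E (\<lambda>i. d i \<omega>) e \<partial>M)
        = P_G * (\<Sum>x\<in>{\<lfloor>\<gamma> * real n\<rfloor> + 1..\<lfloor>\<alpha> * real n\<rfloor>}. T x)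
          + (\<Sum>x\<in>{\<lfloor>\<alpha> * real n\<rfloor> + 1..int l}. T x)
    \<and> (pr = Principle_A \<longrightarrow>
          P_G = (\<Sum>x\<in>{\<lfloor>real g / 2\<rfloor> + 1..int g}. binom_prob p x g)
        \<and> Q_G = (\<Sum>x\<in>{0..\<lfloor>real g / 2\<rfloor>}. binom_prob p x g))
    \<and> (pr = Principle_B \<longrightarrow>
          P_G = std_normal_cdf (\<mu> * sqrt (real g) / \<sigma>)
        \<and> Q_G = std_normal_cdf (- \<mu> * sqrt (real g) / \<sigma>))"
proof -
  define G where "G = group_of n E"
  interpret prob_space M by fact
  note indep = \<open>prob_space.indep_vars M (\<lambda>_. borel) d {1..n}\<close>
  note normal = \<open>\<And>i. i \<in> {1..n} \<Longrightarrow> distributed M lborel (d i) (normal_density \<mu> \<sigma>)\<close>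
  have fin_E: "finite E"
    using \<open>E \<subseteq> {1..n}\<close> finite_subset by blast
  have G: "finite G" "G \<subseteq> {1..n}" "E \<inter> G = {}" "{1..n} = E \<union> G"
    using \<open>E \<subseteq> {1..n}\<close> by (auto simp: G_def group_of_def)
  have card_G: "card G = g"
    using fin_E assms by (simp add: G_def group_of_def card_Diff_subset)
  then have "G \<noteq> {}"
    using \<open>g \<ge> 1\<close> by auto
  have d_E: "distributed M lborel (d i) (normal_density \<mu> \<sigma>)" if "i \<in> E" for i
    using that normal \<open>E \<subseteq> {1..n}\<close> by blast
  have d_G: "distributed M lborel (d i) (normal_density \<mu> \<sigma>)" if "i \<in> G" for i
    using that normal \<open>G \<subseteq> {1..n}\<close> by blast
  have d_G_meas: "random_variable borel (d i)" if "i \<in> G" for i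
    using distributed_measurable[OF d_G[OF that]] by simp
  have indep_E: "indep_vars (\<lambda>_. borel) d E" and indep_G: "indep_vars (\<lambda>_. borel) d G"
    using indep \<open>E \<subseteq> {1..n}\<close> \<open>G \<subseteq> {1..n}\<close> indep_vars_subset by blast+
  define V where "V = {\<omega> \<in> space M. group_votes_for pr G (\<lambda>i. d i \<omega>)}"
  have V: "V \<in> events"
    unfolding V_def using G(1) d_G_meas by (rule events_group_votes_for)
  have P_G: "P_G = prob V"
    by (simp add: \<open>P_G = _\<close> V_def G_def)
  have n_pos: "real n > 0"
    using assms by simp
  \<comment> \<open>Since 2 \<beta> n = l, the number (1 - 2 \<beta>) n equals g. Thus \<gamma> n is
    what the egoists' votes must exceed once all g group members vote for.\<close>
  have \<gamma>_n: "\<gamma> * real n = \<alpha> * real n - real g"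
  proof -
    have "2 * \<beta> * real n = real l"
      using n_pos \<open>\<beta> = _\<close> by simp
    then show ?thesis
      using \<open>n = l + g\<close> by (simp add: \<open>\<gamma> = _\<close> algebra_simps)
  qed

  let ?K = "\<lambda>x :: nat \<Rightarrow> real. real (card {i \<in> E. x i > 0})"
  let ?W = "\<lambda>t (x :: nat \<Rightarrow> real). x e * of_bool (?K x > t) :: real"
  let ?B = "\<lambda>x :: nat \<Rightarrow> real. of_bool (group_votes_for pr G x) :: real"
  have accepted: "accepted pr \<alpha> n E x \<longleftrightarrow> ?K x > (if group_votes_for pr G x then \<gamma> * real n else \<alpha> * real n)"
    for x
  proof -
    have "{i \<in> {1..n}. votes_for pr n E x i}
        = {i \<in> E. x i > 0} \<union> (if group_votes_for pr G x then G else {})"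
      using G by (auto simp: votes_for_def G_def)
    moreover have "card ({i \<in> E. x i > 0} \<union> (if group_votes_for pr G x then G else {}))
        = card {i \<in> E. x i > 0} + (if group_votes_for pr G x then g else 0)"
      using fin_E G(1,3) card_G by (subst card_Un_disjoint) auto
    ultimately have "card {i \<in> {1..n}. votes_for pr n E x i}
        = card {i \<in> E. x i > 0} + (if group_votes_for pr G x then g else 0)"
      by (simp only:)
    then show ?thesis
      by (simp add: accepted_def \<gamma>_n) linarith
  qed
  \<comment> \<open>At most one summand is nonzero, according to the group's vote. In each, the
    first factor reads only coordinates in \<open>E\<close> and the second only coordinates in
    \<open>G\<close>.\<close>
  have increment: "actual_increment pr \<alpha> n E x e = ?W (\<gamma> * real n) x * ?B x + ?W (\<alpha> * real n) x * (1 - ?B x)" for x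
    by (simp add: actual_increment_def accepted)

  have W_int: "integrable M (\<lambda>\<omega>. ?W t (\<lambda>i. d i \<omega>))"
    and W: "expectation (\<lambda>\<omega>. ?W t (\<lambda>i. d i \<omega>)) = (\<Sum>x\<in>{\<lfloor>t\<rfloor> + 1..int l}. T x)" for t
    using expectation_times_card_gt[OF \<open>\<sigma> > 0\<close> fin_E \<open>e \<in> E\<close> indep_E d_E \<open>p = _\<close> \<open>f = _\<close>, of t]
    by (simp_all add: assms(13) assms(20) \<open>q = 1 - p\<close>)
  have W_meas: "?W t \<in> borel_measurable (Pi\<^sub>M E (\<lambda>_. borel))" for t
    using \<open>e \<in> E\<close> by (intro borel_measurable_times borel_measurable_card_positive_gt fin_E) measurable
  have W_restrict: "?W t (restrict x E) = ?W t x" for t x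
  proof -
    have "{i \<in> E. restrict x E i > 0} = {i \<in> E. x i > 0}"
      by auto
    then show ?thesis
      using \<open>e \<in> E\<close> by (simp only: restrict_apply if_True)
  qed
  have B_meas: "?B \<in> borel_measurable (Pi\<^sub>M G (\<lambda>_. borel))"
    using G(1) by (rule borel_measurable_group_votes_for)
  have B_eq: "?B (\<lambda>i. d i \<omega>) = indicator V \<omega>" if "\<omega> \<in> space M" for \<omega>
    using that by (simp add: V_def)
  have B_int: "integrable M (\<lambda>\<omega>. ?B (\<lambda>i. d i \<omega>))"
    using integrable_indicator_event[OF V]
    by (subst Bochner_Integration.integrable_cong[OF refl B_eq])
  have B: "expectation (\<lambda>\<omega>. ?B (\<lambda>i. d i \<omega>)) = P_G"
    by (subst Bochner_Integration.integral_cong[OF refl B_eq]) (use V P_G in auto)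
  \<comment> \<open>The factor in c and c' treats both summands at once: (0, 1) gives the indicator
    of the group's vote for, and (1, -1) its complement.\<close>
  have part: "integrable M (\<lambda>\<omega>. ?W t (\<lambda>i. d i \<omega>) * (c + c' * ?B (\<lambda>i. d i \<omega>)))
      \<and> expectation (\<lambda>\<omega>. ?W t (\<lambda>i. d i \<omega>) * (c + c' * ?B (\<lambda>i. d i \<omega>)))
        = (\<Sum>x\<in>{\<lfloor>t\<rfloor> + 1..int l}. T x) * (c + c' * P_G)" for t c c'
  proof -
    have "(\<lambda>x. c + c' * ?B x) \<in> borel_measurable (Pi\<^sub>M G (\<lambda>_. borel))"
      using B_meas by measurable
    note block = indep_blocks_expectation[OF indep G(3) \<open>E \<subseteq> {1..n}\<close> G(2), where F = "?W t"
        and G = "\<lambda>x. c + c' * ?B x", OF W_meas W_restrict this _ W_int]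
    have int: "integrable M (\<lambda>\<omega>. c + c' * ?B (\<lambda>i. d i \<omega>))"
      using B_int by (intro Bochner_Integration.integrable_add integrable_mult_right) auto
    have "expectation (\<lambda>\<omega>. c + c' * ?B (\<lambda>i. d i \<omega>)) = c + c' * P_G"
      using B_int B by (subst Bochner_Integration.integral_add) (auto simp: prob_space)
    with block[OF _ int] show ?thesis
      by (simp only: W group_votes_for_restrict)
  qed
  have int_for: "integrable M (\<lambda>\<omega>. ?W (\<gamma> * real n) (\<lambda>i. d i \<omega>) * ?B (\<lambda>i. d i \<omega>))"
    and for_eq: "expectation (\<lambda>\<omega>. ?W (\<gamma> * real n) (\<lambda>i. d i \<omega>) * ?B (\<lambda>i. d i \<omega>))
      = (\<Sum>x\<in>{\<lfloor>\<gamma> * real n\<rfloor> + 1..int l}. T x) * P_G"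
    using part[of "\<gamma> * real n" 0 1] by (simp_all only: mult_1_left add_0_left)
  have int_against: "integrable M (\<lambda>\<omega>. ?W (\<alpha> * real n) (\<lambda>i. d i \<omega>) * (1 - ?B (\<lambda>i. d i \<omega>)))"
    and against_eq: "expectation (\<lambda>\<omega>. ?W (\<alpha> * real n) (\<lambda>i. d i \<omega>) * (1 - ?B (\<lambda>i. d i \<omega>)))
      = (\<Sum>x\<in>{\<lfloor>\<alpha> * real n\<rfloor> + 1..int l}. T x) * (1 - P_G)"
    using part[of "\<alpha> * real n" 1 "- 1"] by (simp_all only: mult_minus1 add_uminus_conv_diff)
  have int: "integrable M (\<lambda>\<omega>. actual_increment pr \<alpha> n E (\<lambda>i. d i \<omega>) e)"
    unfolding increment using int_for int_against by (rule Bochner_Integration.integrable_add)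
  have expectation: "expectation (\<lambda>\<omega>. actual_increment pr \<alpha> n E (\<lambda>i. d i \<omega>) e)
      = P_G * (\<Sum>x\<in>{\<lfloor>\<gamma> * real n\<rfloor> + 1..int l}. T x)
        + Q_G * (\<Sum>x\<in>{\<lfloor>\<alpha> * real n\<rfloor> + 1..int l}. T x)"
    unfolding increment Bochner_Integration.integral_add[OF int_for int_against] for_eq against_eq
      \<open>Q_G = 1 - P_G\<close>
    by (simp add: mult.commute)
  \<comment> \<open>The point \<lfloor>\<alpha> n\<rfloor> may lie above l, so the range is first
    extended by indices above l, where the weights vanish, and only then split.\<close>
  have "(\<Sum>x\<in>{\<lfloor>\<gamma> * real n\<rfloor> + 1..int l}. T x)
      = (\<Sum>x\<in>{\<lfloor>\<gamma> * real n\<rfloor> + 1..max \<lfloor>\<alpha> * real n\<rfloor> (int l)}. T x)"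
    by (rule sum.mono_neutral_left) (auto simp: assms(20) binom_prob_def)
  also have "{\<lfloor>\<gamma> * real n\<rfloor> + 1..max \<lfloor>\<alpha> * real n\<rfloor> (int l)}
      = {\<lfloor>\<gamma> * real n\<rfloor> + 1..\<lfloor>\<alpha> * real n\<rfloor>} \<union> {\<lfloor>\<alpha> * real n\<rfloor> + 1..int l}"
  proof -
    have "\<lfloor>\<gamma> * real n\<rfloor> \<le> \<lfloor>\<alpha> * real n\<rfloor>"
      by (rule floor_mono) (simp add: \<gamma>_n)
    then show ?thesis
      by auto
  qed
  also have "(\<Sum>x\<in>\<dots>. T x) = (\<Sum>x\<in>{\<lfloor>\<gamma> * real n\<rfloor> + 1..\<lfloor>\<alpha> * real n\<rfloor>}. T x)
      + (\<Sum>x\<in>{\<lfloor>\<alpha> * real n\<rfloor> + 1..int l}. T x)"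
    by (rule sum.union_disjoint) auto
  \<comment> \<open>The upper sum occurs with the coefficients \<open>P_G\<close> and
    \<open>Q_G\<close>, which add up to one.\<close>
  finally have expectation': "expectation (\<lambda>\<omega>. actual_increment pr \<alpha> n E (\<lambda>i. d i \<omega>) e)
      = P_G * (\<Sum>x\<in>{\<lfloor>\<gamma> * real n\<rfloor> + 1..\<lfloor>\<alpha> * real n\<rfloor>}. T x)
        + (\<Sum>x\<in>{\<lfloor>\<alpha> * real n\<rfloor> + 1..int l}. T x)"
    unfolding expectation by (simp add: \<open>Q_G = 1 - P_G\<close> algebra_simps)

  have A: "P_G = (\<Sum>x\<in>{\<lfloor>real g / 2\<rfloor> + 1..int g}. binom_prob p x g)
      \<and> Q_G = (\<Sum>x\<in>{0..\<lfloor>real g / 2\<rfloor>}. binom_prob p x g)" if "pr = Principle_A"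
    using prob_majority_normal[OF \<open>\<sigma> > 0\<close> G(1) indep_G d_G \<open>p = _\<close>] that
    by (simp add: P_G V_def \<open>Q_G = _\<close> card_G)
  \<comment> \<open>The formula for \<open>Q_G\<close> comes from that for \<open>P_G\<close> by the
    reflection \<open>std_normal_cdf_minus\<close>.\<close>
  have B: "P_G = std_normal_cdf (\<mu> * sqrt (real g) / \<sigma>)
      \<and> Q_G = std_normal_cdf (- \<mu> * sqrt (real g) / \<sigma>)" if "pr = Principle_B"
    using prob_sum_pos_normal[OF \<open>\<sigma> > 0\<close> G(1) \<open>G \<noteq> {}\<close> indep_G d_G] that
      std_normal_cdf_minus[of "\<mu> * sqrt (real g) / \<sigma>"]
    by (simp add: P_G V_def \<open>Q_G = _\<close> card_G)
  show ?thesis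
    using int expectation expectation' A B by blast
qed

end
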